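(* Let $F:\mathbb{R}\to\mathbb{R}$ be real analytic with $F(0)=F'(0)=F''(0)=0$ and $F(x)>0$ for all $x\neq 0$. Let $m$ be the smallest exponent with nonzero coefficient in the Taylor expansion of $F$ at $0$. Then the one-parameter family of differential equations $\dot{x}=r+F(x)$, with $x\in\mathbb{R}$ and parameter $r\in\mathbb{R}$, has a saddle-node bifurcation at $(r,x)=(0,0)$, and its scaling law is $$t(r)\sim r^{-\frac{m-1}{m}}\qquad\text{as } r\to 0^+ .$$
   Context: Saddle-node bifurcation: a family $\dot{x}=f(r,x)$ on $\mathbb{R}$ has a saddle-node bifurcation at $(r,x)=(0,0)$ if, for $(r,x)$ near $(0,0)$, it is orbitally topologically equivalent to the normal form $\dot{x}=r+x^2$ near $(0,0)$. In particular, locally there are no equilibria for $r>0$, exactly one equilibrium for $r=0$, and exactly two equilibria (one attracting, one repelling) for $r<0$. Scaling law: for $r>0$, $t(r)$ denotes the time a trajectory of $\dot{x}=f(r,x)$ spends in the interval $[-1,1]$, passing from $x=-1$ to $x=1$, i.e. $t(r)=\int_{-1}^{1}\frac{dx}{f(r,x)}$. The scaling law is the asymptotic behaviour of $t(r)$ as $r\to 0^+$. Convention: $t(r)\sim a(r)$ as $r\to0^+$ is understood up to a positive multiplicative constant, i.e. $t(r)/a(r)$ tends to a finite positive constant. For example, for $\dot x=r+x^2$ one has $t(r)=2\arctan(1/\sqrt r)/\sqrt r$, which is written $t\sim 1/\sqrt r$. *)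

theory Defs
  imports "HOL-Analysis.Analysis"
begin

definition real_analytic :: "(real \<Rightarrow> real) \<Rightarrow> bool" where
  "real_analytic F \<longleftrightarrow> (\<forall>x. \<exists>A. (\<lambda>h. F (x + h)) has_fps_expansion A)"

definition solution_in :: "(real \<Rightarrow> real) \<Rightarrow> real set \<Rightarrow> real set \<Rightarrow> (real \<Rightarrow> real) \<Rightarrow> bool" where
  "solution_in v X I \<phi> \<longleftrightarrow> open I \<and> is_interval I \<and>
     (\<forall>t\<in>I. \<phi> t \<in> X \<and> (\<phi> has_real_derivative v (\<phi> t)) (at t))"

(* The continuous strictly increasing reparametrization \<tau> of time is what makes h preserve
   the orbits and their direction, but not necessarily the time along them. *)
definition carries_orbits ::
  "(real \<Rightarrow> real) \<Rightarrow> real set \<Rightarrow> (real \<Rightarrow> real) \<Rightarrow> real set \<Rightarrow> (real \<Rightarrow> real) \<Rightarrow> bool" where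
  "carries_orbits v X w Y h \<longleftrightarrow>
     (\<forall>I \<phi>. solution_in v X I \<phi> \<longrightarrow>
        (\<exists>\<tau> \<psi>. strict_mono_on I \<tau> \<and> continuous_on I \<tau> \<and>
                solution_in w Y (\<tau> ` I) \<psi> \<and> (\<forall>t\<in>I. \<psi> (\<tau> t) = h (\<phi> t))))"

(* Local orbital topological equivalence near (0,0) of the families x' = f r x and y' = g s y:
   a homeomorphism between neighbourhoods of (0,0) in the (parameter, state) plane, of the form
   (r, x) \<mapsto> (p r, h r x) and fixing (0,0), that maps the oriented orbits in every slice
   U `` {r} = {x. (r, x) \<in> U} onto those in the slice V `` {p r}.  "Onto" is expressed by
   requiring the inverse to carry orbits as well.  The parameter change p is increasing, so that
   the side of r = 0 on which there are no equilibria is preserved. *)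
definition locally_orbitally_equivalent ::
  "(real \<Rightarrow> real \<Rightarrow> real) \<Rightarrow> (real \<Rightarrow> real \<Rightarrow> real) \<Rightarrow> bool" where
  "locally_orbitally_equivalent f g \<longleftrightarrow>
     (\<exists>U V p h K.
        open U \<and> (0, 0) \<in> U \<and> open V \<and> (0, 0) \<in> V \<and>
        homeomorphism U V (\<lambda>(r, x). (p r, h r x)) K \<and>
        p 0 = 0 \<and> h 0 0 = 0 \<and>
        continuous_on (fst ` U) p \<and> strict_mono_on (fst ` U) p \<and>
        (\<forall>r \<in> fst ` U.
           carries_orbits (f r) (U `` {r}) (g (p r)) (V `` {p r}) (h r) \<and>
           carries_orbits (g (p r)) (V `` {p r}) (f r) (U `` {r}) (\<lambda>y. snd (K (p r, y)))))"

definition saddle_node_bifurcation :: "(real \<Rightarrow> real \<Rightarrow> real) \<Rightarrow> bool" where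
  "saddle_node_bifurcation f \<longleftrightarrow> locally_orbitally_equivalent f (\<lambda>r x. r + x\<^sup>2)"

definition passage_time :: "(real \<Rightarrow> real \<Rightarrow> real) \<Rightarrow> real \<Rightarrow> real" where
  "passage_time f r = integral {-1..1} (\<lambda>x. 1 / f r x)"

(* The scaling law t \<sim> a as r tends to 0 from above, up to a positive multiplicative constant. *)
definition scaling_law :: "(real \<Rightarrow> real \<Rightarrow> real) \<Rightarrow> (real \<Rightarrow> real) \<Rightarrow> bool" where
  "scaling_law f a \<longleftrightarrow> (\<exists>c>0. ((\<lambda>r. passage_time f r / a r) \<longlongrightarrow> c) (at_right 0))"

end

(* The Taylor order m of F is even, its leading coefficient a is positive, and F' has the sign of x
   near 0.  Hence H x = sgn x * sqrt (F x) is an increasing local homeomorphism with H^2 = F, and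
   (r, x) |-> (r, H x) matches the zeros and signs of r + F x with those of r + y^2; in dimension
   one this determines the oriented orbits.

   For the scaling law, write F x = x^m * G x and substitute x = r^(1/m) * u.  This turns t(r) into
   r^(1/m) / r times an integral that converges, by domination with a multiple of 1 / (1 + u^2), to
   the integral of 1 / (1 + a * u^m) over the real line. *)

theory Submission
  imports Defs "HOL-Probability.Sinc_Integral"
begin

section \<open>Orbits of scalar differential equations\<close>

text \<open>The oriented integral from a fixed base point \<open>c\<close> works on both sides of
  \<open>c\<close>. The fundamental theorem is applied on a compact subinterval of \<open>J\<close>
  that contains \<open>c\<close> and has \<open>y\<close> in its interior.\<close>

lemma antiderivative_open_interval:
  fixes g :: "real \<Rightarrow> real"
  assumes "open J" "is_interval J" "continuous_on J g"
  obtains W where "\<And>y. y \<in> J \<Longrightarrow> (W has_real_derivative g y) (at y)"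
proof (cases "J = {}")
  case False
  then obtain c where c: "c \<in> J" by blast
  have "((\<lambda>u. LBINT x=c..u. g x) has_real_derivative g y) (at y)" if y: "y \<in> J" for y
  proof -
    have "min c y \<in> J" "max c y \<in> J" using c y by (auto simp: min_def max_def)
    then obtain d e where de: "d > 0" "e > 0" "cball (min c y) d \<subseteq> J" "cball (max c y) e \<subseteq> J"
      using \<open>open J\<close> by (meson open_contains_cball)
    \<comment> \<open>The margins \<open>d\<close> and \<open>e\<close> put \<open>y\<close>
      strictly between \<open>a\<close> and \<open>b\<close>, which turns the derivative within
      \<open>{a..b}\<close> into a two-sided one.\<close>
    define a b where "a = min c y - d" and "b = max c y + e"
    have "a \<in> cball (min c y) d" "b \<in> cball (max c y) e"
      using de by (simp_all add: a_def b_def dist_real_def)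
    then have "a \<in> J" "b \<in> J" using de by blast+
    then have sub: "{a..b} \<subseteq> J"
      using mem_is_interval_1_I[OF \<open>is_interval J\<close>] by (meson atLeastAtMost_iff subsetI)
    have ab: "a \<le> c" "c \<le> b" "a < y" "y < b"
      using de unfolding a_def b_def by linarith+
    have "((\<lambda>u. LBINT x=c..u. g x) has_vector_derivative g y) (at y within {a..b})"
      using ab by (intro interval_integral_FTC2 continuous_on_subset[OF assms(3) sub]) simp_all
    moreover have "at y within {a..b} = at y"
      using ab by (intro at_within_interior) (simp add: interior_cbox)
    ultimately show ?thesis by (simp add: has_real_derivative_iff_has_vector_derivative)
  qed
  then show ?thesis by (rule that)
qed (use that in auto)

text \<open>Differentiability of \<open>v\<close> at its zero \<open>x0\<close> bounds \<bar>v
  x\<bar> by a multiple of \<bar>x - x0\<bar> near \<open>x0\<close>. A Gronwall argument for the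
  squared distance to \<open>x0\<close> then makes the set of times spent at \<open>x0\<close> open;
  it is also closed in the connected set \<open>I\<close>, hence all of \<open>I\<close>.\<close>

lemma solution_through_equilibrium_constant:
  assumes sol: "solution_in v X I \<phi>"
    and eq: "v x0 = 0" and D: "(v has_real_derivative D) (at x0)"
    and t0: "t0 \<in> I" "\<phi> t0 = x0" and t: "t \<in> I"
  shows "\<phi> t = x0"
proof -
  have I: "open I" "connected I"
    and \<phi>: "\<And>t. t \<in> I \<Longrightarrow> (\<phi> has_real_derivative v (\<phi> t)) (at t)"
    using sol by (auto simp: solution_in_def is_interval_connected_1)
  have cont: "isCont \<phi> t" if "t \<in> I" for t using \<phi>[OF that] by (rule DERIV_isCont)
  \<comment> \<open>The summand 1 makes \<open>L\<close> strictly larger than the limit of the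
    absolute difference quotients, so they stay below \<open>L\<close> near
    \<open>x0\<close>.\<close>
  define L where "L = \<bar>D\<bar> + 1"
  have "((\<lambda>x. (v x - v x0) / (x - x0)) \<longlongrightarrow> D) (at x0)"
    using D by (simp add: has_field_derivative_iff)
  then have "((\<lambda>x. \<bar>(v x - v x0) / (x - x0)\<bar>) \<longlongrightarrow> \<bar>D\<bar>) (at x0)"
    by (intro tendsto_intros)
  then have "eventually (\<lambda>x. \<bar>(v x - v x0) / (x - x0)\<bar> < L) (at x0)"
    by (rule order_tendstoD) (simp add: L_def)
  then obtain d where d: "d > 0" "\<And>x. x \<noteq> x0 \<Longrightarrow> \<bar>x - x0\<bar> < d \<Longrightarrow> \<bar>v x / (x - x0)\<bar> < L"
    unfolding eventually_at by (auto simp: eq dist_real_def)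
  have lip: "\<bar>v x\<bar> \<le> L * \<bar>x - x0\<bar>" if "\<bar>x - x0\<bar> < d" for x
  proof (cases "x = x0")
    case False
    then have "\<bar>v x\<bar> / \<bar>x - x0\<bar> < L" using d(2)[OF False that] by (simp only: abs_divide)
    then show ?thesis using False by (simp add: pos_divide_less_eq)
  qed (simp add: eq)
  have lip2: "\<bar>(x - x0) * v x\<bar> \<le> L * (x - x0)\<^sup>2" if "\<bar>x - x0\<bar> < d" for x
  proof -
    have "\<bar>x - x0\<bar> * \<bar>v x\<bar> \<le> \<bar>x - x0\<bar> * (L * \<bar>x - x0\<bar>)"
      by (rule mult_left_mono[OF lip[OF that]]) simp
    also have "\<dots> = L * \<bar>x - x0\<bar>\<^sup>2" by (simp add: power2_eq_square)
    finally show ?thesis by (simp only: abs_mult power2_abs)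
  qed
  have "open {t \<in> I. \<phi> t = x0}"
    unfolding open_dist
  proof (rule ballI)
    fix t1 assume "t1 \<in> {t \<in> I. \<phi> t = x0}"
    then have t1: "t1 \<in> I" "\<phi> t1 = x0" by simp_all
    have "eventually (\<lambda>s. \<bar>\<phi> s - x0\<bar> < d) (nhds t1)"
      using tendstoD[OF cont[OF t1(1), unfolded isCont_def tendsto_at_iff_tendsto_nhds] d(1)]
      by (simp add: dist_real_def t1(2))
    moreover have "eventually (\<lambda>s. s \<in> I) (nhds t1)"
      using I t1 by (intro eventually_nhds_in_open)
    ultimately have "eventually (\<lambda>s. s \<in> I \<and> \<bar>\<phi> s - x0\<bar> < d) (nhds t1)"
      by eventually_elim auto
    then obtain e where e: "e > 0" "\<And>s. dist s t1 < e \<Longrightarrow> s \<in> I \<and> \<bar>\<phi> s - x0\<bar> < d"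
      unfolding eventually_nhds_metric by blast
    \<comment> \<open>The exponent \<open>c\<close> stays free: \<open>- (2 * L)\<close> makes the
      weighted square nonincreasing after \<open>t1\<close>, and \<open>2 * L\<close> makes it
      nondecreasing before \<open>t1\<close>. It is nonnegative and vanishes at \<open>t1\<close>,
      so it vanishes on both sides.\<close>
    have der: "((\<lambda>s. (\<phi> s - x0)\<^sup>2 * exp (c * s)) has_real_derivative
        (2 * ((\<phi> s - x0) * v (\<phi> s)) + c * (\<phi> s - x0)\<^sup>2) * exp (c * s)) (at s)" if "dist s t1 < e" for s c
    proof -
      have "s \<in> I" using e(2)[OF that] by blast
      note \<phi>' = \<phi>[OF this]
      show ?thesis
        by (rule derivative_eq_intros \<phi>' refl)+ (simp add: power2_eq_square algebra_simps)
    qed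
    have lip3: "\<bar>(\<phi> u - x0) * v (\<phi> u)\<bar> \<le> L * (\<phi> u - x0)\<^sup>2" if "dist u t1 < e" for u
      using e(2)[OF that] lip2 by blast
    have "\<phi> s = x0" if s: "dist s t1 < e" for s
    proof (cases "t1 \<le> s")
      case True
      have "(\<phi> s - x0)\<^sup>2 * exp (- (2 * L) * s) \<le> (\<phi> t1 - x0)\<^sup>2 * exp (- (2 * L) * t1)"
      proof (rule DERIV_nonpos_imp_nonincreasing[OF True])
        fix u assume "t1 \<le> u" "u \<le> s"
        then have u: "dist u t1 < e" using s by (auto simp: dist_real_def)
        show "\<exists>y. ((\<lambda>s. (\<phi> s - x0)\<^sup>2 * exp (- (2 * L) * s)) has_real_derivative y) (at u) \<and> y \<le> 0"
        proof (intro exI conjI, rule der[OF u])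
          show "(2 * ((\<phi> u - x0) * v (\<phi> u)) + - (2 * L) * (\<phi> u - x0)\<^sup>2) * exp (- (2 * L) * u) \<le> 0"
            using lip3[OF u] by (intro mult_nonpos_nonneg) (simp_all add: abs_le_iff)
        qed
      qed
      then show ?thesis using t1(2) by (simp add: mult_le_0_iff)
    next
      case False
      then have le: "s \<le> t1" by simp
      have "(\<phi> s - x0)\<^sup>2 * exp ((2 * L) * s) \<le> (\<phi> t1 - x0)\<^sup>2 * exp ((2 * L) * t1)"
      proof (rule DERIV_nonneg_imp_nondecreasing[OF le])
        fix u assume "s \<le> u" "u \<le> t1"
        then have u: "dist u t1 < e" using s by (auto simp: dist_real_def)
        show "\<exists>y. ((\<lambda>s. (\<phi> s - x0)\<^sup>2 * exp ((2 * L) * s)) has_real_derivative y) (at u) \<and> 0 \<le> y"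
        proof (intro exI conjI, rule der[OF u])
          show "0 \<le> (2 * ((\<phi> u - x0) * v (\<phi> u)) + (2 * L) * (\<phi> u - x0)\<^sup>2) * exp ((2 * L) * u)"
            using lip3[OF u] by (intro mult_nonneg_nonneg) (simp_all add: abs_le_iff)
        qed
      qed
      then show ?thesis using t1(2) by (simp add: mult_le_0_iff)
    qed
    then show "\<exists>e>0. \<forall>y. dist y t1 < e \<longrightarrow> y \<in> {t \<in> I. \<phi> t = x0}"
      using e by blast
  qed
  moreover have "continuous_on I \<phi>" by (simp add: cont continuous_at_imp_continuous_on)
  ultimately have "\<forall>t\<in>I. \<phi> t = x0"
    using continuous_levelset_open[OF I(2), of \<phi> x0] t0 by blast
  with t show ?thesis by blast
qed

section \<open>Monotone trajectories and transport of orbits\<close>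

lemma deriv_pos_imp_strict_mono_on:
  fixes f :: "real \<Rightarrow> real"
  assumes "is_interval I" "\<And>t. t \<in> I \<Longrightarrow> (f has_real_derivative f' t) (at t)" "\<And>t. t \<in> I \<Longrightarrow> f' t > 0"
  shows "strict_mono_on I f"
proof (rule strict_mono_onI)
  fix a b assume ab: "a \<in> I" "b \<in> I" "a < b"
  then have "x \<in> I" if "a \<le> x" "x \<le> b" for x
    using mem_is_interval_1_I[OF assms(1) ab(1,2)] that by blast
  then show "f a < f b"
    using assms by (intro DERIV_pos_imp_increasing[OF ab(3)]) blast
qed

lemma deriv_neg_imp_strict_antimono_on:
  fixes f :: "real \<Rightarrow> real"
  assumes "is_interval I" "\<And>t. t \<in> I \<Longrightarrow> (f has_real_derivative f' t) (at t)" "\<And>t. t \<in> I \<Longrightarrow> f' t < 0"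
  shows "strict_antimono_on I f"
proof (rule monotone_onI)
  fix a b assume ab: "a \<in> I" "b \<in> I" "a < b"
  then have "x \<in> I" if "a \<le> x" "x \<le> b" for x
    using mem_is_interval_1_I[OF assms(1) ab(1,2)] that by blast
  then show "f a > f b"
    using assms by (intro DERIV_neg_imp_decreasing[OF ab(3)]) blast
qed

text \<open>
  A solution avoiding the zeros of \<open>v\<close> is strictly monotone, so time along its image is measured by
  an antiderivative \<open>W\<close> of \<open>1 / w\<close>, and \<open>\<tau> = W \<circ> H \<circ> \<phi>\<close>. This needs no differentiability of \<open>H\<close>.
\<close>
lemma carries_orbits_of_strict_mono:
  assumes H: "continuous_on X H" "strict_mono_on X H" "H ` X \<subseteq> Y"
    and sgn: "\<And>x. x \<in> X \<Longrightarrow> sgn (w (H x)) = sgn (v x)"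
    and v: "continuous_on X v" and w: "continuous_on Y w"
    and D: "\<And>x. x \<in> X \<Longrightarrow> v x = 0 \<Longrightarrow> \<exists>D. (v has_real_derivative D) (at x)"
  shows "carries_orbits v X w Y H"
  unfolding carries_orbits_def
proof (intro allI impI)
  fix I \<phi> assume sol: "solution_in v X I \<phi>"
  then have I: "open I" "is_interval I"
    and \<phi>: "\<And>t. t \<in> I \<Longrightarrow> (\<phi> has_real_derivative v (\<phi> t)) (at t)" "\<And>t. t \<in> I \<Longrightarrow> \<phi> t \<in> X"
    by (auto simp: solution_in_def)
  have c\<phi>: "continuous_on I \<phi>"
    using \<phi>(1) DERIV_isCont continuous_at_imp_continuous_on by blast
  show "\<exists>\<tau> \<psi>. strict_mono_on I \<tau> \<and> continuous_on I \<tau> \<and>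
                solution_in w Y (\<tau> ` I) \<psi> \<and> (\<forall>t\<in>I. \<psi> (\<tau> t) = H (\<phi> t))"
  \<comment> \<open>A solution that meets a zero of \<open>v\<close> is constant, and its image is
    an equilibrium of \<open>w\<close>, so time need not be changed. Otherwise \<open>W\<close> is
    available.\<close>
  proof (cases "\<exists>t0\<in>I. v (\<phi> t0) = 0")
    case True
    then obtain t0 where t0: "t0 \<in> I" "v (\<phi> t0) = 0" by blast
    then obtain D where "(v has_real_derivative D) (at (\<phi> t0))" using D \<phi>(2) by blast
    then have const: "\<phi> t = \<phi> t0" if "t \<in> I" for t
      using solution_through_equilibrium_constant[OF sol t0(2) _ t0(1) refl that] by blast
    have "w (H (\<phi> t0)) = 0" using sgn[OF \<phi>(2)[OF t0(1)]] t0(2) by (simp add: sgn_zero_iff)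
    then have "solution_in w Y I (\<lambda>_. H (\<phi> t0))"
      using I H(3) \<phi>(2)[OF t0(1)] by (auto simp: solution_in_def)
    then have "solution_in w Y ((\<lambda>t. t) ` I) (\<lambda>_. H (\<phi> t0))" by simp
    moreover have "\<forall>t\<in>I. H (\<phi> t0) = H (\<phi> t)"
      using const by metis
    moreover have "strict_mono_on I (\<lambda>t. t)" by (rule strict_mono_onI)
    ultimately show ?thesis using continuous_on_id by blast
  next
    case False
    define G where "G = (\<lambda>t. H (\<phi> t))"
    define J where "J = G ` I"
    have cG: "continuous_on I G"
      unfolding G_def using \<phi>(2) by (intro continuous_on_compose2[OF H(1) c\<phi>]) auto
    have JY: "J \<subseteq> Y" using H(3) \<phi>(2) by (auto simp: J_def G_def)
    have J: "is_interval J"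
      using connected_continuous_image[OF cG] I(2) unfolding J_def is_interval_connected_1 by blast
    have sgnG: "sgn (w (G t)) = sgn (v (\<phi> t))" if "t \<in> I" for t
      using sgn[OF \<phi>(2)[OF that]] by (simp add: G_def)
    have w0: "w y \<noteq> 0" if y: "y \<in> J" for y
    proof -
      obtain t where t: "t \<in> I" "y = G t" using y by (auto simp: J_def)
      have "v (\<phi> t) \<noteq> 0" using False t(1) by blast
      then show ?thesis using sgnG[OF t(1)] t(2) by (metis sgn_zero_iff)
    qed
    have cv: "continuous_on I (\<lambda>t. v (\<phi> t))"
      using \<phi>(2) by (intro continuous_on_compose2[OF v c\<phi>]) auto
    have iv: "is_interval ((\<lambda>t. v (\<phi> t)) ` I)"
      using connected_continuous_image[OF cv] I(2) unfolding is_interval_connected_1 by blast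
    \<comment> \<open>Intermediate value theorem: \<open>v\<close> along \<phi> is continuous and
      has no zero on the interval \<open>I\<close>.\<close>
    have pos_neg: "(\<forall>t\<in>I. v (\<phi> t) > 0) \<or> (\<forall>t\<in>I. v (\<phi> t) < 0)"
    proof (rule ccontr)
      assume neg: "\<not> ?thesis"
      obtain a where a: "a \<in> I" "v (\<phi> a) \<le> 0" using neg by (meson not_less)
      obtain b where b: "b \<in> I" "0 \<le> v (\<phi> b)" using neg by (meson not_less)
      have "0 \<in> (\<lambda>t. v (\<phi> t)) ` I"
        using mem_is_interval_1_I[OF iv imageI[OF a(1)] imageI[OF b(1)] a(2) b(2)] .
      then obtain t where "t \<in> I" "0 = v (\<phi> t)" by (rule imageE)
      with False show False by metis
    qed
    have invw: "continuous_on J (\<lambda>y. 1 / w y)"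
      using continuous_on_subset[OF w JY] w0 by (intro continuous_intros) auto
    \<comment> \<open>An injective continuous map on an open subset of the line is open. This makes
      \<open>J\<close> an open interval, on which \<open>1 / w\<close> has an
      antiderivative.\<close>
    have "inj_on G I"
      using pos_neg
    proof
      assume "\<forall>t\<in>I. v (\<phi> t) > 0"
      then have "strict_mono_on I \<phi>" by (intro deriv_pos_imp_strict_mono_on[OF I(2) \<phi>(1)]) auto
      then show ?thesis using \<phi>(2) H(2) unfolding G_def
        by (intro strict_mono_on_imp_inj_on) (auto simp: strict_mono_on_def)
    next
      assume "\<forall>t\<in>I. v (\<phi> t) < 0"
      then have anti: "strict_antimono_on I \<phi>"
        by (intro deriv_neg_imp_strict_antimono_on[OF I(2) \<phi>(1)]) auto
      have "inj_on H X" using H(2) by (rule strict_mono_on_imp_inj_on)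
      moreover have "inj_on \<phi> I"
        using anti by (intro linorder_inj_onI') (fastforce simp: monotone_on_def)
      ultimately show ?thesis using \<phi>(2) unfolding G_def inj_on_def by blast
    qed
    then have "open J"
      unfolding J_def using I(1) cG by (intro injective_into_1d_imp_open_map_UNIV) auto
    obtain W where W: "\<And>y. y \<in> J \<Longrightarrow> (W has_real_derivative 1 / w y) (at y)"
      using antiderivative_open_interval[OF \<open>open J\<close> J invw] by blast
    have cW: "continuous_on J W"
      using W DERIV_isCont continuous_at_imp_continuous_on by blast
    define \<tau> where "\<tau> = (\<lambda>t. W (G t))"
    have c\<tau>: "continuous_on I \<tau>"
      unfolding \<tau>_def by (intro continuous_on_compose2[OF cW cG]) (auto simp: J_def)
    \<comment> \<open>In the negative case \<phi> and \<open>W\<close> both decrease while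
      \<open>H\<close> increases, so their composite \<tau> still increases.\<close>
    have mono: "strict_mono_on I \<tau> \<and> inj_on W J"
      using pos_neg
    proof
      assume pos: "\<forall>t\<in>I. v (\<phi> t) > 0"
      then have "strict_mono_on I \<phi>" by (intro deriv_pos_imp_strict_mono_on[OF I(2) \<phi>(1)]) auto
      moreover have "w y > 0" if "y \<in> J" for y
        using that pos sgnG sgn_1_pos by (fastforce simp: J_def)
      then have WJ: "strict_mono_on J W"
        by (intro deriv_pos_imp_strict_mono_on[OF J W]) auto
      ultimately show ?thesis
        using \<phi>(2) H(2) strict_mono_on_imp_inj_on[OF WJ]
        unfolding \<tau>_def G_def J_def by (auto simp: strict_mono_on_def)
    next
      assume neg: "\<forall>t\<in>I. v (\<phi> t) < 0"
      then have "strict_antimono_on I \<phi>"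
        by (intro deriv_neg_imp_strict_antimono_on[OF I(2) \<phi>(1)]) auto
      moreover have "w y < 0" if "y \<in> J" for y
        using that neg sgnG sgn_1_neg by (fastforce simp: J_def)
      then have WJ: "strict_antimono_on J W"
        by (intro deriv_neg_imp_strict_antimono_on[OF J W]) auto
      moreover have "inj_on W J"
        using WJ by (intro linorder_inj_onI') (fastforce simp: monotone_on_def)
      ultimately show ?thesis
        using \<phi>(2) H(2) unfolding \<tau>_def G_def J_def by (auto simp: monotone_on_def)
    qed
    define \<psi> where "\<psi> = inv_into J W"
    have \<psi>: "\<psi> (W y) = y" if "y \<in> J" for y
      using mono that by (simp add: \<psi>_def)
    \<comment> \<open>By the inverse function theorem the inverse of \<open>W\<close> has derivative
      \<open>w y\<close> at \<open>W y\<close>, which is the differential equation for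
      \<psi>.\<close>
    have der: "(\<psi> has_real_derivative w y) (at (W y))" if y: "y \<in> J" for y
    proof -
      have "(\<psi> has_derivative (*) (w y)) (at (W y))"
        using W[OF y] w0[OF y] \<psi> y \<open>open J\<close> cW
        by (intro has_derivative_inverse_strong[where f = W and f' = "(*) (1 / w y)"])
           (auto simp: has_field_derivative_def fun_eq_iff)
      then show ?thesis by (simp add: has_field_derivative_def)
    qed
    have "open (\<tau> ` I)"
      using mono I(1) c\<tau> by (intro injective_into_1d_imp_open_map_UNIV[of I I])
        (auto intro: strict_mono_on_imp_inj_on)
    moreover have "is_interval (\<tau> ` I)"
      using connected_continuous_image[OF c\<tau>] I(2) unfolding is_interval_connected_1 by blast
    ultimately have "solution_in w Y (\<tau> ` I) \<psi>"
      using der \<psi> JY by (auto simp: solution_in_def \<tau>_def J_def)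
    moreover have "\<psi> (\<tau> t) = H (\<phi> t)" if "t \<in> I" for t
      using \<psi>[of "G t"] that by (simp add: J_def \<tau>_def G_def)
    ultimately show ?thesis using mono c\<tau> by blast
  qed
qed

section \<open>Taylor order of a real analytic function\<close>

text \<open>Differentiating the expansion \<open>n\<close> times and evaluating at 0 isolates the
  coefficient. This identifies the Taylor order, given through iterated derivatives, with the
  subdegree of the series.\<close>

lemma fps_nth_has_fps_expansion_real:
  fixes f :: "real \<Rightarrow> real"
  assumes "f has_fps_expansion A"
  shows "fps_nth A n = (deriv ^^ n) f 0 / fact n"
proof -
  have "(deriv ^^ n) f has_fps_expansion (fps_deriv ^^ n) A"
    using assms by (induction n) (auto intro: has_fps_expansion_deriv)
  then have "eventually (\<lambda>z. eval_fps ((fps_deriv ^^ n) A) z = (deriv ^^ n) f z) (nhds 0)"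
    by (simp add: has_fps_expansion_def)
  then have "eval_fps ((fps_deriv ^^ n) A) 0 = (deriv ^^ n) f 0"
    by (rule eventually_nhds_x_imp_x)
  then show ?thesis
    by (simp add: eval_fps_at_0 fps_0th_higher_deriv field_simps)
qed

text \<open>Division by \<open>x ^ n\<close> shifts the series; the shifted expansion is continuous
  at 0, and its value there is the coefficient of index \<open>n\<close>.\<close>

lemma has_fps_expansion_quotient_tendsto:
  fixes f :: "real \<Rightarrow> real"
  assumes "f has_fps_expansion A" "n \<le> subdegree A"
  shows "((\<lambda>x. f x / x ^ n) \<longlongrightarrow> fps_nth A n) (at 0)"
proof -
  have "continuous (at 0) (\<lambda>x. if x = 0 then fps_nth A n else f x / x ^ n)"
    using has_fps_expansion_imp_continuous[OF has_fps_expansion_shift[OF assms refl]] .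
  then have "((\<lambda>x. if x = 0 then fps_nth A n else f x / x ^ n) \<longlongrightarrow> fps_nth A n) (at 0)"
    by (simp add: isCont_def)
  then show ?thesis
    by (rule Lim_transform_eventually) (simp add: eventually_at_filter)
qed

lemma real_analytic_has_derivative:
  assumes "real_analytic F"
  shows "(F has_real_derivative deriv F x) (at x)"
proof -
  obtain A where A: "(\<lambda>h. F (x + h)) has_fps_expansion A"
    using assms by (auto simp: real_analytic_def)
  have "(eval_fps A has_real_derivative eval_fps (fps_deriv A) 0) (at 0)"
    using A by (intro has_field_derivative_eval_fps) (simp add: has_fps_expansion_def zero_ereal_def)
  then have "((\<lambda>h. F (h + x)) has_real_derivative eval_fps (fps_deriv A) 0) (at 0)"
    using A by (subst (asm) DERIV_cong_ev[OF refl _ refl, of _ "\<lambda>h. F (h + x)"])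
      (auto simp: has_fps_expansion_def add.commute)
  then have "(F has_real_derivative eval_fps (fps_deriv A) 0) (at x)"
    using DERIV_shift[of F _ 0 x] by simp
  then show ?thesis by (simp add: DERIV_imp_deriv)
qed

text \<open>Positivity of \<open>F\<close> fixes the leading term: the limit of
  \<open>F x / x ^ m\<close> from the right gives \<open>a\<close> \<ge> 0, and for odd
  \<open>m\<close> the limit from the left would give \<open>a\<close> \<le> 0.\<close>

lemma leading_term_of_positive:
  fixes F :: "real \<Rightarrow> real"
  assumes F: "real_analytic F" and F0: "F 0 = 0" and F1: "deriv F 0 = 0"
    and pos: "\<And>x. x \<noteq> 0 \<Longrightarrow> F x > 0"
    and m: "m = (LEAST n. (deriv ^^ n) F 0 / fact n \<noteq> 0)"
  obtains a where "a > 0" "even m" "m \<ge> 2" "((\<lambda>x. F x / x ^ m) \<longlongrightarrow> a) (at 0)"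
    "((\<lambda>x. deriv F x / x ^ (m - 1)) \<longlongrightarrow> real m * a) (at 0)"
proof -
  obtain A where "(\<lambda>h. F (0 + h)) has_fps_expansion A"
    using F unfolding real_analytic_def by blast
  then have A: "F has_fps_expansion A" by simp
  have nth: "fps_nth A n = (deriv ^^ n) F 0 / fact n" for n
    using A by (rule fps_nth_has_fps_expansion_real)
  \<comment> \<open>A zero series would make \<open>F\<close> vanish near 0. With this excluded, the
    subdegree is the least index of a nonzero coefficient.\<close>
  have "A \<noteq> 0"
  proof
    assume "A = 0"
    then have "eventually (\<lambda>x. 0 = F x) (nhds 0)"
      using A by (simp add: has_fps_expansion_def)
    then have "eventually (\<lambda>x. 0 = F x) (at 0)"
      by (simp add: eventually_at_filter eventually_mono)
    moreover have "eventually (\<lambda>x::real. x \<noteq> 0) (at 0)" by (simp add: eventually_at_filter)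
    ultimately have "eventually (\<lambda>x::real. False) (at 0)"
      by eventually_elim (metis pos less_irrefl)
    then show False by simp
  qed
  then have sub: "subdegree A = m" by (simp add: subdegree_def m nth)
  define a where "a = fps_nth A m"
  have a: "a \<noteq> 0" using \<open>A \<noteq> 0\<close> sub by (auto simp: a_def)
  have m2: "m \<ge> 2"
  proof (rule ccontr)
    assume "\<not> ?thesis"
    then have "m = 0 \<or> m = 1" by auto
    then show False using a nth[of 0] nth[of 1] F0 F1 by (auto simp: a_def)
  qed
  have lim: "((\<lambda>x. F x / x ^ m) \<longlongrightarrow> a) (at 0)"
    using has_fps_expansion_quotient_tendsto[OF A] sub by (simp add: a_def)
  then have lim_right: "((\<lambda>x. F x / x ^ m) \<longlongrightarrow> a) (at_right 0)"
    and lim_left: "((\<lambda>x. F x / x ^ m) \<longlongrightarrow> a) (at_left 0)"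
    by (simp_all add: filterlim_at_split)
  have "eventually (\<lambda>x. 0 \<le> F x / x ^ m) (at_right 0)"
    using eventually_at_right_less[of 0]
    by eventually_elim (simp add: less_imp_le[OF pos])
  then have "a \<ge> 0"
    by (intro tendsto_lowerbound[OF lim_right]) simp_all
  then have a_pos: "a > 0" using a by simp
  have ev: "even m"
  proof (rule ccontr)
    assume "odd m"
    have "eventually (\<lambda>x::real. x < 0) (at_left 0)"
      by (simp add: eventually_at_filter)
    then have "eventually (\<lambda>x. F x / x ^ m \<le> 0) (at_left 0)"
    proof eventually_elim
      case (elim x)
      then have "x ^ m < 0" using \<open>odd m\<close> by (simp add: power_less_zero_eq)
      then show ?case using pos[of x] elim by (simp add: divide_nonneg_neg)
    qed
    then have "a \<le> 0"
      by (intro tendsto_upperbound[OF lim_left]) simp_all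
    with a_pos show False by simp
  qed
  have "subdegree (fps_deriv A) \<ge> m - 1"
  proof (rule subdegree_geI)
    have "fps_nth (fps_deriv A) (m - 1) \<noteq> 0" using m2 a by (simp add: a_def)
    then show "fps_deriv A \<noteq> 0" by (metis fps_zero_nth)
  qed (simp add: sub nth_less_subdegree_zero)
  then have "((\<lambda>x. deriv F x / x ^ (m - 1)) \<longlongrightarrow> fps_nth (fps_deriv A) (m - 1)) (at 0)"
    by (intro has_fps_expansion_quotient_tendsto has_fps_expansion_deriv A)
  also have "fps_nth (fps_deriv A) (m - 1) = real m * a" using m2 by (simp add: a_def)
  finally show ?thesis using that a_pos ev m2 lim by blast
qed

section \<open>Conjugation to the normal form\<close>

text \<open>The factor \<open>sgn x\<close> reflects the decreasing left branch of \<open>F\<close>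
  below the axis, where it increases; the branches join at 0 because \<open>F 0 = 0\<close>.\<close>

lemma strict_mono_on_sgn_mult:
  fixes F :: "real \<Rightarrow> real"
  assumes F: "\<And>x. (F has_real_derivative F' x) (at x)" and F0: "F 0 = 0"
    and right: "\<And>x. 0 < x \<Longrightarrow> x < d \<Longrightarrow> F' x > 0"
    and left: "\<And>x. - d < x \<Longrightarrow> x < 0 \<Longrightarrow> F' x < 0"
  shows "strict_mono_on {-d<..<d} (\<lambda>x. sgn x * F x)"
proof -
  have cont: "continuous_on S F" for S
    using F DERIV_isCont continuous_at_imp_continuous_on by blast
  have pos: "F x < F y" if "0 \<le> x" "x < y" "y < d" for x y
    using that right F by (intro DERIV_pos_imp_increasing_open[OF that(2) _ cont]) force
  have neg: "F y < F x" if "- d < x" "x < y" "y \<le> 0" for x y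
    using that left F by (intro DERIV_neg_imp_decreasing_open[OF that(2) _ cont]) force
  show ?thesis
  proof (rule strict_mono_onI)
    fix x y assume xy: "x \<in> {-d<..<d}" "y \<in> {-d<..<d}" "x < y"
    consider "0 \<le> x" | "y \<le> 0" | "x < 0" "0 < y" by linarith
    then show "sgn x * F x < sgn y * F y"
    proof cases
      case 1
      then show ?thesis using pos[of x y] xy F0 by (cases "x = 0") auto
    next
      case 2
      then show ?thesis using neg[of x y] xy F0 by (cases "y = 0") auto
    next
      case 3
      then show ?thesis using neg[of x 0] pos[of 0 y] xy F0 by auto
    qed
  qed
qed

lemma continuous_on_sgn_mult:
  fixes F :: "real \<Rightarrow> real"
  assumes "continuous_on UNIV F" "F 0 = 0"
  shows "continuous_on UNIV (\<lambda>x. sgn x * F x)"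
proof -
  have "continuous_on ({..0} \<union> {0..}) (\<lambda>x. if x \<le> 0 then - F x else F x)"
    using assms by (intro continuous_on_cases continuous_on_minus)
      (auto intro: continuous_on_subset)
  moreover have "(\<lambda>x. if x \<le> 0 then - F x else F x) = (\<lambda>x. sgn x * F x)"
    using assms(2) by (auto simp: fun_eq_iff sgn_real_def)
  moreover have "{..0} \<union> {0..} = (UNIV :: real set)" by auto
  ultimately show ?thesis by metis
qed

lemma saddle_node_bifurcation_of_squared_coordinate:
  fixes F H :: "real \<Rightarrow> real"
  assumes S: "open S" "0 \<in> S" and H: "continuous_on S H" "strict_mono_on S H" "H 0 = 0"
    and sq: "\<And>x. x \<in> S \<Longrightarrow> (H x)\<^sup>2 = F x"
    and F: "\<And>x. (F has_real_derivative F' x) (at x)"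
  shows "saddle_node_bifurcation (\<lambda>r x. r + F x)"
proof -
  have inj: "inj_on H S" using H(2) by (rule strict_mono_on_imp_inj_on)
  obtain g where g: "homeomorphism S (H ` S) H g"
    using invariance_of_domain_homeomorphism[OF S(1) H(1) _ inj] by auto
  have opT: "open (H ` S)"
    using S(1) H(1) inj by (intro injective_into_1d_imp_open_map_UNIV) auto
  have gT: "g y \<in> S" "H (g y) = y" if "y \<in> H ` S" for y
    using g that by (auto simp: homeomorphism_def)
  have cg: "continuous_on (H ` S) g" using g by (simp add: homeomorphism_def)
  have mg: "strict_mono_on (H ` S) g"
  proof (rule strict_mono_onI)
    fix y z assume yz: "y \<in> H ` S" "z \<in> H ` S" "y < z"
    then show "g y < g z"
      using strict_mono_on_less[OF H(2) gT(1) gT(1), of y z] by (simp add: gT)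
  qed
  have cF: "continuous_on A F" for A
    using F DERIV_isCont continuous_at_imp_continuous_on by blast
  have homeo: "homeomorphism (UNIV \<times> S) (UNIV \<times> H ` S) (\<lambda>(r :: real, x). (r, H x)) (\<lambda>(r, y). (r, g y))"
  proof (rule homeomorphismI)
    show "continuous_on (UNIV \<times> S) (\<lambda>(r :: real, x). (r, H x))"
      unfolding case_prod_unfold
      by (intro continuous_intros continuous_on_compose2[OF H(1)]) auto
    show "continuous_on (UNIV \<times> H ` S) (\<lambda>(r :: real, y). (r, g y))"
      unfolding case_prod_unfold
      by (intro continuous_intros continuous_on_compose2[OF cg]) auto
  qed (use g gT in \<open>auto simp: homeomorphism_def\<close>)
  have forward: "carries_orbits (\<lambda>x. r + F x) S (\<lambda>y. r + y\<^sup>2) (H ` S) H" for r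
  proof (intro carries_orbits_of_strict_mono H)
    show "\<exists>D. ((\<lambda>x. r + F x) has_real_derivative D) (at x)" for x
      using F by (intro exI[of _ "F' x"]) (auto intro!: derivative_eq_intros)
  qed (auto simp: sq intro!: continuous_intros cF)
  have backward: "carries_orbits (\<lambda>y. r + y\<^sup>2) (H ` S) (\<lambda>x. r + F x) S g" for r
  proof (intro carries_orbits_of_strict_mono cg mg)
    show "sgn (r + F (g y)) = sgn (r + y\<^sup>2)" if "y \<in> H ` S" for y
      using gT[OF that] sq[of "g y"] by simp
    show "\<exists>D. ((\<lambda>y. r + y\<^sup>2) has_real_derivative D) (at y)" for y
      by (auto intro!: derivative_eq_intros)
  qed (use gT in \<open>auto intro!: continuous_intros cF\<close>)
  have slice: "((UNIV :: real set) \<times> T) `` {r} = T" for T :: "real set" and r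
    by auto
  show ?thesis
    unfolding saddle_node_bifurcation_def locally_orbitally_equivalent_def
  proof (intro exI conjI)
    show "open ((UNIV :: real set) \<times> S)" using S by (intro open_Times) auto
    show "open ((UNIV :: real set) \<times> H ` S)" using opT by (intro open_Times) auto
    show "(0, 0) \<in> (UNIV :: real set) \<times> S" "(0, 0) \<in> (UNIV :: real set) \<times> H ` S"
      using S(2) H(3) by (auto simp: image_iff intro: bexI[of _ 0])
    show "homeomorphism (UNIV \<times> S) (UNIV \<times> H ` S) (\<lambda>(r :: real, x). (r, H x)) (\<lambda>(r, y). (r, g y))"
      by (rule homeo)
    show "\<forall>r \<in> fst ` (UNIV \<times> S).
           carries_orbits (\<lambda>x. r + F x) ((UNIV \<times> S) `` {r}) (\<lambda>x. r + x\<^sup>2) ((UNIV \<times> H ` S) `` {r}) H \<and>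
           carries_orbits (\<lambda>x. r + x\<^sup>2) ((UNIV \<times> H ` S) `` {r}) (\<lambda>x. r + F x) ((UNIV \<times> S) `` {r})
             (\<lambda>y. snd ((\<lambda>(r, y). (r, g y)) (r, y)))"
      using forward backward by (simp add: slice)
  qed (auto simp: H(3) strict_mono_on_def)
qed

text \<open>Near 0 the derivative has the sign of \<open>x ^ k\<close>, which is that of
  \<open>x\<close> for odd \<open>k\<close>. So \<open>sgn x * F x\<close> is increasing, and its
  real square root is the coordinate \<open>H\<close>.\<close>

lemma saddle_node_bifurcation_positive_analytic:
  fixes F :: "real \<Rightarrow> real"
  assumes F: "real_analytic F" and F0: "F 0 = 0" and pos: "\<And>x. x \<noteq> 0 \<Longrightarrow> F x > 0"
    and lim: "((\<lambda>x. deriv F x / x ^ k) \<longlongrightarrow> b) (at 0)" "b > 0" "odd k"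
  shows "saddle_node_bifurcation (\<lambda>r x. r + F x)"
proof -
  note der = real_analytic_has_derivative[OF F]
  have "eventually (\<lambda>x. deriv F x / x ^ k > 0) (at 0)"
    using lim by (intro order_tendstoD)
  then obtain d where d: "d > 0" "\<And>x. x \<noteq> 0 \<Longrightarrow> \<bar>x\<bar> < d \<Longrightarrow> deriv F x / x ^ k > 0"
    unfolding eventually_at by (auto simp: dist_real_def)
  have "deriv F x > 0" if "0 < x" "x < d" for x
    using d(2)[of x] that by (simp add: zero_less_divide_iff)
  moreover have "deriv F x < 0" if "- d < x" "x < 0" for x
  proof -
    have "x ^ k < 0" using that lim(3) by (simp add: power_less_zero_eq)
    moreover have "deriv F x / x ^ k > 0" using d(2)[of x] that by simp
    ultimately show ?thesis by (metis zero_less_divide_iff less_asym)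
  qed
  ultimately have mono: "strict_mono_on {-d<..<d} (\<lambda>x. sgn x * F x)"
    by (intro strict_mono_on_sgn_mult[OF der F0]) auto
  have cF: "continuous_on UNIV F"
    using der DERIV_isCont continuous_at_imp_continuous_on by blast
  have cont: "continuous_on {-d<..<d} (\<lambda>x. sgn x * F x)"
    using continuous_on_subset[OF continuous_on_sgn_mult[OF cF F0]] by blast
  \<comment> \<open>Isabelle's square root is odd, so the coordinate below is \<open>- sqrt (F x)\<close> for negative \<open>x\<close>.\<close>
  show ?thesis
  proof (rule saddle_node_bifurcation_of_squared_coordinate[OF _ _ _ _ _ _ der])
    show "open {-d<..<d}" "0 \<in> {-d<..<d}" using d(1) by auto
    show "continuous_on {-d<..<d} (\<lambda>x. sqrt (sgn x * F x))"
      using cont by (rule continuous_on_real_sqrt)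
    show "strict_mono_on {-d<..<d} (\<lambda>x. sqrt (sgn x * F x))"
      using mono by (simp add: strict_mono_on_def)
    show "(sqrt (sgn x * F x))\<^sup>2 = F x" for x
      using pos[of x] F0 by (cases "x < 0"; cases "x = 0") (auto simp: real_sqrt_minus)
  qed simp
qed

section \<open>Scaling law\<close>

lemma integrable_inverse_one_plus_square:
  "integrable lborel (\<lambda>x :: real. 1 / (1 + x\<^sup>2))"
  using integrable_inverse_1_plus_square
  by (simp add: set_integrable_def einterval_def inverse_eq_divide)

text \<open>From \<open>u\<^sup>2 - 1\<close> \<le> \<open>u ^ m\<close> the right side is at least
  \<open>1 - b + b * u\<^sup>2\<close>, and \<open>b\<close> \<le> 1/2 gives \<open>1 - b\<close>
  \<ge> \<open>b\<close>. The bound makes the rescaled integrands dominated by a multiple of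
  \<open>1 / (1 + u\<^sup>2)\<close>.\<close>

lemma one_plus_square_le_one_plus_power:
  fixes u b g :: real
  assumes "even m" "m \<ge> 2" "0 < b" "b \<le> 1 / 2" "b \<le> g"
  shows "b * (1 + u\<^sup>2) \<le> 1 + g * u ^ m"
proof -
  have um: "u ^ m = \<bar>u\<bar> ^ m" using assms(1) by (simp add: power_even_abs)
  have "u\<^sup>2 - 1 \<le> u ^ m"
  proof (cases "\<bar>u\<bar> \<le> 1")
    case True
    then have "u\<^sup>2 \<le> 1" by (simp add: abs_square_le_1)
    moreover have "0 \<le> u ^ m" unfolding um by simp
    ultimately show ?thesis by linarith
  next
    case False
    then have "\<bar>u\<bar>\<^sup>2 \<le> \<bar>u\<bar> ^ m" using assms(2) by (intro power_increasing) auto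
    then show ?thesis unfolding um by simp
  qed
  then have "b * (u\<^sup>2 - 1) \<le> b * u ^ m" using assms(3) by (intro mult_left_mono) auto
  also have "\<dots> \<le> g * u ^ m" using assms(5) um by (intro mult_right_mono) auto
  finally show ?thesis using assms(4) by (simp add: algebra_simps)
qed

text \<open>As \<open>s\<close> tends to 0 the window \<bar>s * u\<bar> \<le> 1 exhausts the line
  and \<open>G (s * u)\<close> tends to \<open>G 0\<close>. Dominated convergence gives as
  \<open>c\<close> the integral of \<open>1 / (1 + G 0 * u ^ m)\<close> over the line.\<close>

lemma rescaled_integral_tendsto:
  fixes G :: "real \<Rightarrow> real"
  assumes G: "continuous_on UNIV G" and pos: "\<And>x. G x > 0" and m: "even m" "m \<ge> 2"
  shows "\<exists>c>0. ((\<lambda>s. LBINT u. indicator {-1..1} (s * u) / (1 + G (s * u) * u ^ m)) \<longlongrightarrow> c) (at_right 0)"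
proof -
  define k where "k = (\<lambda>s u. indicator {-1..1} (s * u) / (1 + G (s * u) * u ^ m))"
  define k0 where "k0 = (\<lambda>u. 1 / (1 + G 0 * u ^ m))"
  obtain x0 where x0: "\<And>x. x \<in> {-1..1} \<Longrightarrow> G x0 \<le> G x"
    using continuous_attains_inf[of "{-1..1}" G] continuous_on_subset[OF G subset_UNIV]
    by (metis atLeastAtMost_iff compact_Icc empty_iff neg_le_0_iff_le zero_le_one)
  \<comment> \<open>A lower bound of \<open>G\<close> on \<open>{-1..1}\<close> suffices for the
    domination, as the indicator kills the integrand when \<open>s * u\<close> lies outside.\<close>
  define b where "b = min (G x0) (1 / 2)"
  have b: "0 < b" "b \<le> 1 / 2" "\<And>x. x \<in> {-1..1} \<Longrightarrow> b \<le> G x"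
    using pos[of x0] x0 by (auto simp: b_def min_le_iff_disj)
  have um: "u ^ m \<ge> 0" for u :: real using m(1) by (rule zero_le_even_power)
  have den: "1 + G x * u ^ m > 0" for x u
    using mult_nonneg_nonneg[OF less_imp_le[OF pos[of x]] um[of u]] by linarith
  have bound: "norm (k s u) \<le> 1 / b * (1 / (1 + u\<^sup>2))" for s u
  proof (cases "s * u \<in> {-1..1}")
    case True
    have "b * (1 + u\<^sup>2) \<le> 1 + G (s * u) * u ^ m"
      using one_plus_square_le_one_plus_power[OF m b(1,2) b(3)[OF True]] .
    moreover have "0 < b * (1 + u\<^sup>2)" using b(1) by (simp add: add_pos_nonneg)
    ultimately have "1 / (1 + G (s * u) * u ^ m) \<le> 1 / (b * (1 + u\<^sup>2))"
      using den[of "s * u" u] by (intro divide_left_mono) (simp_all add: mult.commute mult_pos_pos)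
    then show ?thesis using True den[of "s * u" u] by (simp add: k_def)
  next
    case False
    then show ?thesis using b(1) by (simp add: k_def)
  qed
  have meas: "k s \<in> borel_measurable lborel" for s
  proof -
    have [measurable]: "G \<in> borel_measurable borel"
      using G by (rule borel_measurable_continuous_onI)
    show ?thesis unfolding k_def by measurable
  qed
  have meas0: "k0 \<in> borel_measurable lborel" unfolding k0_def by measurable
  have w: "integrable lborel (\<lambda>u :: real. 1 / b * (1 / (1 + u\<^sup>2)))"
    using integrable_inverse_one_plus_square by (rule integrable_mult_right)
  have ptw: "(\<lambda>i. k (X i) u) \<longlonglongrightarrow> k0 u" if X: "X \<longlonglongrightarrow> 0" for X u
  proof -
    have Xu: "(\<lambda>i. X i * u) \<longlonglongrightarrow> 0" using tendsto_mult_left_zero[OF X] .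
    have "isCont G 0" using G by (simp add: continuous_on_eq_continuous_at)
    then have "(\<lambda>i. G (X i * u)) \<longlonglongrightarrow> G 0" using Xu by (rule isCont_tendsto_compose)
    then have "(\<lambda>i. 1 / (1 + G (X i * u) * u ^ m)) \<longlonglongrightarrow> k0 u"
      unfolding k0_def using den[of 0 u] by (intro tendsto_intros) auto
    moreover have "eventually (\<lambda>i. \<bar>X i * u\<bar> < 1) sequentially"
      using tendstoD[OF Xu, of 1] by simp
    then have "eventually (\<lambda>i. 1 / (1 + G (X i * u) * u ^ m) = k (X i) u) sequentially"
      by eventually_elim (auto simp: k_def indicator_def)
    ultimately show ?thesis by (rule Lim_transform_eventually)
  qed
  \<comment> \<open>Integrability of the limit also comes from dominated convergence, along one
    concrete null sequence.\<close>
  have int0: "integrable lborel k0"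
    by (rule integrable_dominated_convergence[OF meas0 meas w, of "\<lambda>i. inverse (real (Suc i))"])
       (intro AE_I2 bound ptw LIMSEQ_inverse_real_of_nat)+
  have lim: "((\<lambda>s. integral\<^sup>L lborel (k s)) \<longlongrightarrow> integral\<^sup>L lborel k0) (at_right 0)"
    unfolding tendsto_at_iff_sequentially comp_def
    by (intro allI impI integral_dominated_convergence[OF meas0 meas w] AE_I2 bound ptw)
  \<comment> \<open>Positivity of the limit: on \<open>{0..1}\<close> the integrand is at least its
    value at 1, and elsewhere it is positive.\<close>
  have "0 < 1 / (1 + G 0)" using pos[of 0] by simp
  also have "1 / (1 + G 0) = (LBINT u::real. indicator {0..1} u * (1 / (1 + G 0)))"
    using pos[of 0] by simp
  also have "\<dots> \<le> integral\<^sup>L lborel k0"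
  proof (rule integral_mono[OF _ int0])
    show "integrable lborel (\<lambda>u :: real. indicator {0..1} u * (1 / (1 + G 0)))"
      by (intro integrable_mult_left integrable_real_indicator) auto
    show "indicator {0..1} u * (1 / (1 + G 0)) \<le> k0 u" for u
    proof (cases "u \<in> {0..1}")
      case True
      then have "u ^ m \<le> 1" by (simp add: power_le_one)
      then have "G 0 * u ^ m \<le> G 0" using pos[of 0] by (simp add: mult_left_le)
      then show ?thesis using True den[of 0 u] pos[of 0]
        by (simp add: k0_def frac_le)
    next
      case False
      then show ?thesis using den[of 0 u] by (simp add: k0_def)
    qed
  qed
  finally show ?thesis using lim unfolding k_def by blast
qed

lemma scaling_law_power_order:
  fixes F :: "real \<Rightarrow> real"
  assumes F: "continuous_on UNIV F" and F0: "F 0 = 0" and pos: "\<And>x. x \<noteq> 0 \<Longrightarrow> F x > 0"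
    and m: "even m" "m \<ge> 2" and lim: "((\<lambda>x. F x / x ^ m) \<longlongrightarrow> a) (at 0)" and a: "a > 0"
  shows "scaling_law (\<lambda>r x. r + F x) (\<lambda>r. r powr (- ((real m - 1) / real m)))"
proof -
  \<comment> \<open>Filling in the limit \<open>a\<close> at 0 makes \<open>G\<close> continuous;
    evenness of \<open>m\<close> makes it positive everywhere.\<close>
  define G where "G = (\<lambda>x. if x = 0 then a else F x / x ^ m)"
  have FG: "F x = x ^ m * G x" for x using F0 m(2) by (auto simp: G_def)
  have Gpos: "G x > 0" for x
    using a pos[of x] m(1) by (auto simp: G_def zero_less_power_eq)
  have Fnn: "F x \<ge> 0" for x using F0 pos[of x] by (cases "x = 0") auto
  have "isCont G x" for x
  proof (cases "x = 0")
    case True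
    have "((\<lambda>x. G x) \<longlongrightarrow> a) (at 0)"
      using lim by (rule Lim_transform_eventually) (simp add: eventually_at_filter G_def)
    then show ?thesis by (simp add: True isCont_def G_def)
  next
    case False
    have "isCont F x" using F by (simp add: continuous_on_eq_continuous_at)
    then have "isCont (\<lambda>x. F x / x ^ m) x" using False by (intro continuous_intros) auto
    moreover have "eventually (\<lambda>y. y \<noteq> 0) (nhds x)" using False by (rule t1_space_nhds)
    then have "eventually (\<lambda>y. F y / y ^ m = G y) (nhds x)"
      by eventually_elim (simp add: G_def)
    ultimately show ?thesis by (subst (asm) isCont_cong)
  qed
  then have G: "continuous_on UNIV G" by (simp add: continuous_on_eq_continuous_at)
  define K where "K = (\<lambda>s. LBINT u. indicator {-1..1} (s * u) / (1 + G (s * u) * u ^ m))"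
  obtain c where c: "c > 0" "(K \<longlongrightarrow> c) (at_right 0)"
    using rescaled_integral_tendsto[OF G Gpos m] unfolding K_def by blast
  \<comment> \<open>With \<open>s ^ m = r\<close>, the substitution \<open>x = s * u\<close>
    contributes the factor \<open>s\<close>, and \<open>r + F (s * u)\<close> becomes
    \<open>r * (1 + G (s * u) * u ^ m)\<close>.\<close>
  have time: "passage_time (\<lambda>r x. r + F x) r = K (root m r) * (root m r / r)" if r: "r > 0" for r
  proof -
    define s where "s = root m r"
    have s: "s > 0" "s ^ m = r" using r m(2) by (simp_all add: s_def)
    \<comment> \<open>Continuity on the compact interval lets the gauge integral in
      \<open>passage_time\<close> be read as a Lebesgue integral, for which the substitution is
      carried out.\<close>
    have "continuous_on {-1..1} (\<lambda>x. 1 / (r + F x))"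
    proof (intro continuous_intros continuous_on_subset[OF F] ballI)
      show "r + F x \<noteq> 0" for x using Fnn[of x] r by linarith
    qed simp
    then have "set_integrable lborel {-1..1} (\<lambda>x. 1 / (r + F x))"
      by (rule borel_integrable_atLeastAtMost')
    from set_borel_integral_eq_integral(2)[OF this]
    have "passage_time (\<lambda>r x. r + F x) r = (LBINT x. indicator {-1..1} x / (r + F x))"
      by (simp add: passage_time_def set_lebesgue_integral_def)
    also have "\<dots> = s * (LBINT u. indicator {-1..1} (s * u) / (r + F (s * u)))"
      using lborel_integral_real_affine[of s "\<lambda>x. indicator {-1..1} x / (r + F x)" 0] s by simp
    also have "(\<lambda>u. indicator {-1..1} (s * u) / (r + F (s * u))) =
        (\<lambda>u. 1 / r * (indicator {-1..1} (s * u) / (1 + G (s * u) * u ^ m)))"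
    proof
      fix u
      have "r + F (s * u) = r * (1 + G (s * u) * u ^ m)"
        by (simp add: FG power_mult_distrib s(2) algebra_simps)
      then show "indicator {-1..1} (s * u) / (r + F (s * u)) =
          1 / r * (indicator {-1..1} (s * u) / (1 + G (s * u) * u ^ m))" by simp
    qed
    also have "(LBINT u. 1 / r * (indicator {-1..1} (s * u) / (1 + G (s * u) * u ^ m))) = 1 / r * K s"
      unfolding K_def by (rule integral_mult_right_zero)
    finally show ?thesis by (simp add: s_def)
  qed
  have "filterlim (root m) (at_right 0) (at_right 0)"
  proof (rule filterlim_at[THEN iffD2], intro conjI)
    have "isCont (root m) 0" using m(2) by (intro isCont_real_root)
    then have "(root m \<longlongrightarrow> 0) (at 0)" by (simp add: isCont_def)
    then show "(root m \<longlongrightarrow> 0) (at_right 0)" by (rule filterlim_mono) (simp_all add: at_le)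
    show "eventually (\<lambda>r. root m r \<in> {0<..} \<and> root m r \<noteq> 0) (at_right 0)"
      using eventually_at_right_less[of 0] by eventually_elim (use m(2) in auto)
  qed
  then have "((\<lambda>r. K (root m r)) \<longlongrightarrow> c) (at_right 0)"
    using c(2) by (rule filterlim_compose[rotated])
  moreover have "eventually (\<lambda>r. K (root m r) =
      passage_time (\<lambda>r x. r + F x) r / r powr (- ((real m - 1) / real m))) (at_right 0)"
    using eventually_at_right_less[of 0]
  proof eventually_elim
    case (elim r)
    have "r powr (- ((real m - 1) / real m)) = r powr (1 / real m - 1)"
      using m(2) by (simp add: diff_divide_distrib)
    also have "\<dots> = root m r / r"
      using elim m(2) by (simp add: powr_diff root_powr_inverse)
    finally show ?case using elim m(2) by (simp add: time)
  qed
  ultimately have "((\<lambda>r. passage_time (\<lambda>r x. r + F x) r / r powr (- ((real m - 1) / real m)))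
      \<longlongrightarrow> c) (at_right 0)"
    by (rule Lim_transform_eventually)
  then show ?thesis using c(1) unfolding scaling_law_def by blast
qed

theorem proposition2p1:
  fixes F :: "real \<Rightarrow> real" and m :: nat
  assumes "real_analytic F"
    and "F 0 = 0" and "deriv F 0 = 0" and "deriv (deriv F) 0 = 0"
    and "\<And>x. x \<noteq> 0 \<Longrightarrow> F x > 0"
    and "m = (LEAST n. (deriv ^^ n) F 0 / fact n \<noteq> 0)"
  shows "saddle_node_bifurcation (\<lambda>r x. r + F x) \<and>
         scaling_law (\<lambda>r x. r + F x) (\<lambda>r. r powr (- ((real m - 1) / real m)))"
proof -
  obtain a where a: "a > 0" "even m" "m \<ge> 2" "((\<lambda>x. F x / x ^ m) \<longlongrightarrow> a) (at 0)"
      "((\<lambda>x. deriv F x / x ^ (m - 1)) \<longlongrightarrow> real m * a) (at 0)"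
    using leading_term_of_positive[OF assms(1-3,5,6)] by blast
  have "continuous_on UNIV F"
    using real_analytic_has_derivative[OF assms(1)] DERIV_isCont continuous_at_imp_continuous_on
    by blast
  then have "scaling_law (\<lambda>r x. r + F x) (\<lambda>r. r powr (- ((real m - 1) / real m)))"
    using scaling_law_power_order assms(2,5) a(1-4) by blast
  moreover have "saddle_node_bifurcation (\<lambda>r x. r + F x)"
    \<comment> \<open>Here \<open>k = m - 1\<close> is odd because \<open>m\<close> is even and at
      least 2, and \<open>b = real m * a\<close> is positive.\<close>
    using a by (intro saddle_node_bifurcation_positive_analytic[OF assms(1,2,5) a(5)]) auto
  ultimately show ?thesis by blast
qed

end
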